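(* Assume $\mathcal Z$ is a polyhedron, every $g_{i,j}$ is affine, $J$ is convex and piecewise affine, and $V_i=\sum_{j}[g_{i,j}]_+$ for each $i$. Assume also: $\mathcal Z$ is compact, the minima in the lexicographic cascade are attained, the set of minimizers of $J$ on $\mathcal F_L$ is non-empty, and the weighted-sum problem has a minimizer for every $w\in\mathbb R^L_{++}$; and the lexicographic optimum $z^\star_{\mathrm{lex}}$ is unique, with uniquely determined image $p^\star$. Then any $w\in\Omega(p^\star)$ with $$(w,1)\in\operatorname{relint}N^+_{\overline{\mathcal P}}(p^\star)$$ exposes $p^\star$ as a singleton, i.e. $p^\star$ is the unique minimizer of $q\mapsto\langle(w,1),q\rangle$ over $\overline{\mathcal P}$, and therefore $z^\star_{\mathrm{ws}}(w)=z^\star_{\mathrm{lex}}$ (every weighted-sum minimizer at $w$ equals $z^\star_{\mathrm{lex}}$). In particular, if the hyperplane $\{(w,1):w\in\mathbb R^L\}$ intersects $\operatorname{int}N^+_{\overline{\mathcal P}}(p^\star)$ inside the positive orthant (i.e. at some $(w,1)$ with $w\in\mathbb R_{++}^L$), then every $w\in\operatorname{int}\Omega(p^\star)$ is an exact-equivalence weight, $z^\star_{\mathrm{ws}}(w)=z^\star_{\mathrm{lex}}$, and reproduces the exact compliance vector, $b(z^\star_{\mathrm{ws}}(w))=b(z^\star_{\mathrm{lex}})$.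
   Context: Let $L\ge1$, $m_1,\dots,m_L\ge1$ and $d\ge 1$ be integers. $\mathcal Z\subset\mathbb R^d$ is the feasible set, $J:\mathbb R^d\to\mathbb R$ is the performance objective, and $g_{i,j}:\mathbb R^d\to\mathbb R$ ($1\le i\le L$, $1\le j\le m_i$) are constraint functions, level $i=1$ having the highest priority. Write $[a]_+=\max(0,a)$ and $\mathbb R_{++}^L=(0,\infty)^L$. The violation functionals are $V_i(z)=\sum_{j=1}^{m_i}[g_{i,j}(z)]_+$. Lexicographic cascade: $\mathcal F_0=\mathcal Z$, and for $i=1,\dots,L$, $V_i^\star=\min_{z\in\mathcal F_{i-1}}V_i(z)$, $\mathcal F_i=\{z\in\mathcal F_{i-1}:V_i(z)=V_i^\star\}$. The lexicographic optimum is $z^\star_{\mathrm{lex}}\in\arg\min_{z\in\mathcal F_L}J(z)$, with $J^\star=J(z^\star_{\mathrm{lex}})$ and image $p^\star=(V_1^\star,\dots,V_L^\star,J^\star)\in\mathbb R^{L+1}$. Weighted-sum problem: for $w\in\mathbb R_{++}^L$, $z^\star_{\mathrm{ws}}(w)\in\arg\min_{z\in\mathcal Z}J(z)+\sum_i w_iV_i(z)$. Upper image: $\overline{\mathcal P}=\mathrm{cl}\{(y,t)\in\mathbb R^{L}\times\mathbb R:\exists z\in\mathcal Z,\ V_i(z)\le y_i\ \forall i,\ J(z)\le t\}$. Outward normal cone (in the paper's sign convention): $N^+_{\overline{\mathcal P}}(p^\star)=\{\eta\in\mathbb R^{L+1}:\langle\eta,q-p^\star\rangle\ge0\ \forall q\in\overline{\mathcal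 P}\}$. Normalized equivalence region: $\Omega(p^\star)=\{w\in\mathbb R_{++}^L:(w,1)\in N^+_{\overline{\mathcal P}}(p^\star)\}$. $\operatorname{relint}$ denotes relative interior. Exact compliance vector: $b(z)=(\mathbb 1[V_1(z)=0],\dots,\mathbb 1[V_L(z)=0])\in\{0,1\}^L$. *)

theory Defs
  imports "HOL-Analysis.Analysis"
begin

(* Priority levels are the elements of a finite linearly ordered type 'l: the least element
   is level 1 (highest priority) and L = CARD('l). R^L x R is the type (real^'l) * real. *)

definition argmin_on :: "('a \<Rightarrow> real) \<Rightarrow> 'a set \<Rightarrow> 'a set" where
  "argmin_on f S = {x. is_arg_min f (\<lambda>x. x \<in> S) x}"

definition affine_fun_on :: "'a::real_inner set \<Rightarrow> ('a \<Rightarrow> real) \<Rightarrow> bool" where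
  "affine_fun_on S f \<longleftrightarrow> (\<exists>a c. \<forall>z\<in>S. f z = a \<bullet> z + c)"

definition piecewise_affine :: "('a::euclidean_space \<Rightarrow> real) \<Rightarrow> bool" where
  "piecewise_affine f \<longleftrightarrow>
     (\<exists>\<P>. finite \<P> \<and> \<Union>\<P> = UNIV \<and> (\<forall>P\<in>\<P>. polyhedron P \<and> affine_fun_on P f))"

definition violation :: "('l \<Rightarrow> nat) \<Rightarrow> ('l \<Rightarrow> nat \<Rightarrow> 'a \<Rightarrow> real) \<Rightarrow> 'l \<Rightarrow> 'a \<Rightarrow> real" where
  "violation m g i z = (\<Sum>j=1..m i. max 0 (g i j z))"

(* The level preceded by exactly k others, i.e. level k + 1 in one-based numbering. *)
definition level :: "nat \<Rightarrow> 'l::{finite,linorder}" where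
  "level k = (THE i. card {..<i} = k)"

lemma level_card_lessThan: "level (card {..<i}) = (i :: 'l::{finite,linorder})"
  unfolding level_def
proof (rule the_equality)
  fix j :: 'l
  assume "card {..<j} = card {..<i}"
  moreover have "card {..<a} < card {..<b}" if "a < b" for a b :: 'l
    using that by (intro psubset_card_mono) auto
  ultimately show "j = i"
    by (metis less_irrefl linorder_less_linear)
qed simp

(* cascade V Z k is F_k. The infimum is the minimum whenever the latter is attained,
   see argmin_on_Inf. *)
primrec cascade :: "('l::{finite,linorder} \<Rightarrow> 'a \<Rightarrow> real) \<Rightarrow> 'a set \<Rightarrow> nat \<Rightarrow> 'a set" where
  "cascade V Z 0 = Z"
| "cascade V Z (Suc k) =
     {z \<in> cascade V Z k. V (level k) z = (INF z'\<in>cascade V Z k. V (level k) z')}"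

lemma argmin_on_Inf: "x \<in> argmin_on f S \<Longrightarrow> f x = (INF z\<in>S. f z)"
  unfolding argmin_on_def is_arg_min_linorder
  by (rule sym, rule cInf_eq_minimum) auto

(* F_{i-1}, as card {..<i} levels come before i. *)
definition before_level :: "('l::{finite,linorder} \<Rightarrow> 'a \<Rightarrow> real) \<Rightarrow> 'a set \<Rightarrow> 'l \<Rightarrow> 'a set" where
  "before_level V Z i = cascade V Z (card {..<i})"

definition V_star :: "('l::{finite,linorder} \<Rightarrow> 'a \<Rightarrow> real) \<Rightarrow> 'a set \<Rightarrow> 'l \<Rightarrow> real" where
  "V_star V Z i = (INF z\<in>before_level V Z i. V i z)"

definition lex_optima ::
    "('l::{finite,linorder} \<Rightarrow> 'a \<Rightarrow> real) \<Rightarrow> ('a \<Rightarrow> real) \<Rightarrow> 'a set \<Rightarrow> 'a set" where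
  "lex_optima V J Z = argmin_on J (cascade V Z CARD('l))"

definition ws_optima ::
    "('l::finite \<Rightarrow> 'a \<Rightarrow> real) \<Rightarrow> ('a \<Rightarrow> real) \<Rightarrow> 'a set \<Rightarrow> real^'l \<Rightarrow> 'a set" where
  "ws_optima V J Z w = argmin_on (\<lambda>z. J z + (\<Sum>i\<in>UNIV. w $ i * V i z)) Z"

definition upper_image ::
    "('l::finite \<Rightarrow> 'a \<Rightarrow> real) \<Rightarrow> ('a \<Rightarrow> real) \<Rightarrow> 'a set \<Rightarrow> ((real^'l) \<times> real) set" where
  "upper_image V J Z = closure {(y, t). \<exists>z\<in>Z. (\<forall>i. V i z \<le> y $ i) \<and> J z \<le> t}"

(* The sign convention is that of the dual cone of P - p: inner products are nonnegative. *)
definition normal_cone :: "'a::real_inner set \<Rightarrow> 'a \<Rightarrow> 'a set" where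
  "normal_cone P p = {\<eta>. \<forall>q\<in>P. \<eta> \<bullet> (q - p) \<ge> 0}"

definition pos_orthant :: "(real^'l) set" where
  "pos_orthant = {w. \<forall>i. 0 < w $ i}"

definition equiv_region :: "((real^'l::finite) \<times> real) set \<Rightarrow> (real^'l) \<times> real \<Rightarrow> (real^'l) set" where
  "equiv_region P p = {w \<in> pos_orthant. (w, 1) \<in> normal_cone P p}"

definition compliance :: "('l::finite \<Rightarrow> 'a \<Rightarrow> real) \<Rightarrow> 'a \<Rightarrow> nat^'l" where
  "compliance V z = (\<chi> i. if V i z = 0 then 1 else 0)"

end

theory Submission
  imports Defs
begin

text \<open>
  Write \<open>f z = (V z, J z)\<close>. Lexicographic optimality of \<open>z\<^sub>l\<^sub>e\<^sub>x\<close> says that every \<open>f z - p\<close> with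
  \<open>z \<in> Z\<close> and \<open>p = f z\<^sub>l\<^sub>e\<^sub>x\<close> is lexicographically nonnegative. The lexicographically nonnegative
  vectors form a convex cone that contains no line and contains the nonnegative orthant, but this
  cone is not closed, so it cannot be used directly in a separation argument on the closed set
  \<open>P\<close>. This is where the piecewise affine data enter: \<open>Z\<close> splits into finitely
  many polytopes on which \<open>f\<close> is affine, so \<open>f ` Z\<close> lies in the convex hull of the images of finitely
  many vertices (\<open>piecewise_affine_image_hull\<close>), and \<open>P - p\<close> lies in a finitely generated, hence
  closed, subcone \<open>K\<close> of the lexicographic cone (\<open>upper_image_in_closed_cone\<close>).

  If \<open>\<eta>\<close> is a relative interior point of the normal cone and \<open>v = q - p\<close> with \<open>q \<in> P\<close> satisfies
  \<open>\<eta> \<bullet> v = 0\<close>, then \<open>v\<close> is orthogonal to the whole normal cone, in particular to the dual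
  cone of \<open>K\<close>. By the bipolar theorem both \<open>v\<close> and \<open>-v\<close> are in \<open>K\<close>, so \<open>v = 0\<close>
  (\<open>rel_interior_normal_cone_exposes\<close>). Hence \<open>p\<close> is the only minimizer over \<open>P\<close>, so
  that \<open>f\<close> maps every weighted-sum minimizer to \<open>p\<close>. This makes it a lexicographic optimum,
  and there is only one of those (\<open>ws_optima_eq_lex_optima\<close>). Finally, an interior point
  \<open>w\<close> of the equivalence region gives an interior point \<open>(w, 1)\<close> of the normal cone by
  homogeneity, which reduces the second claim to the first.
\<close>

section \<open>Piecewise affine images\<close>

lemma affine_fun_on_subset: "affine_fun_on S f \<Longrightarrow> T \<subseteq> S \<Longrightarrow> affine_fun_on T f"
  unfolding affine_fun_on_def by blast

lemma affine_fun_on_sum: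
  assumes "\<And>i. i \<in> I \<Longrightarrow> affine_fun_on S (f i)"
  shows "affine_fun_on S (\<lambda>z. \<Sum>i\<in>I. f i z)"
proof -
  have "\<forall>i\<in>I. \<exists>a c. \<forall>z\<in>S. f i z = a \<bullet> z + c"
    using assms by (auto simp: affine_fun_on_def)
  then obtain a c where "\<forall>i\<in>I. \<forall>z\<in>S. f i z = a i \<bullet> z + c i"
    by metis
  then have "\<forall>z\<in>S. (\<Sum>i\<in>I. f i z) = (\<Sum>i\<in>I. a i) \<bullet> z + (\<Sum>i\<in>I. c i)"
    by (simp add: inner_sum_left sum.distrib)
  then show ?thesis
    unfolding affine_fun_on_def by blast
qed

lemma common_affine_cells:
  assumes "finite I" "\<And>i. i \<in> I \<Longrightarrow> piecewise_affine (f i)"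
  shows "\<exists>\<P>. finite \<P> \<and> \<Union>\<P> = UNIV \<and>
           (\<forall>P\<in>\<P>. polyhedron P \<and> (\<forall>i\<in>I. affine_fun_on P (f i)))"
  using assms
proof (induction I rule: finite_induct)
  case empty
  show ?case by (intro exI[of _ "{UNIV}"]) auto
next
  case (insert i I)
  have "\<exists>\<P>. finite \<P> \<and> \<Union>\<P> = UNIV \<and>
      (\<forall>P\<in>\<P>. polyhedron P \<and> (\<forall>i\<in>I. affine_fun_on P (f i)))"
    by (rule insert.IH) (simp add: insert.prems)
  then obtain \<P> where \<P>: "finite \<P>" "\<Union>\<P> = UNIV"
      "\<And>P. P \<in> \<P> \<Longrightarrow> polyhedron P \<and> (\<forall>i\<in>I. affine_fun_on P (f i))"
    by blast
  obtain \<Q> where \<Q>: "finite \<Q>" "\<Union>\<Q> = UNIV"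
      "\<And>P. P \<in> \<Q> \<Longrightarrow> polyhedron P \<and> affine_fun_on P (f i)"
    using insert.prems[of i] by (auto simp: piecewise_affine_def)
  let ?R = "(\<lambda>(P, Q). P \<inter> Q) ` (\<P> \<times> \<Q>)"
  have "finite ?R"
    using \<P> \<Q> by simp
  moreover have "\<Union>?R = UNIV"
    using \<P>(2) \<Q>(2) by fastforce
  moreover have "polyhedron P \<and> (\<forall>j\<in>insert i I. affine_fun_on P (f j))" if "P \<in> ?R" for P
    using that \<P>(3) \<Q>(3) by (auto intro: affine_fun_on_subset)
  ultimately show ?case by (intro exI[of _ ?R] conjI[rotated] ballI) (simp_all only:)
qed

lemma piecewise_affine_sum:
  assumes "finite I" "\<And>i. i \<in> I \<Longrightarrow> piecewise_affine (f i)"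
  shows "piecewise_affine (\<lambda>z. \<Sum>i\<in>I. f i z)"
proof -
  obtain \<P> where "finite \<P>" "\<Union>\<P> = UNIV"
      "\<forall>P\<in>\<P>. polyhedron P \<and> (\<forall>i\<in>I. affine_fun_on P (f i))"
    using common_affine_cells[of I f, OF assms] by blast
  then show ?thesis
    unfolding piecewise_affine_def by (intro exI[of _ \<P>]) (auto intro: affine_fun_on_sum)
qed

lemma piecewise_affine_pos_part:
  assumes "affine_fun_on UNIV f"
  shows "piecewise_affine (\<lambda>z. max 0 (f z))"
proof -
  obtain a c where f: "\<And>z. f z = a \<bullet> z + c"
    using assms by (auto simp: affine_fun_on_def)
  let ?A = "{z. a \<bullet> z \<le> - c}" and ?B = "{z. a \<bullet> z \<ge> - c}"
  have "affine_fun_on ?A (\<lambda>z. max 0 (f z))"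
    unfolding affine_fun_on_def by (intro exI[of _ 0]) (auto simp: f)
  moreover have "affine_fun_on ?B (\<lambda>z. max 0 (f z))"
    unfolding affine_fun_on_def by (intro exI[of _ a] exI[of _ c]) (auto simp: f)
  ultimately show ?thesis
    unfolding piecewise_affine_def
    by (intro exI[of _ "{?A, ?B}"]) (auto simp: polyhedron_halfspace_le polyhedron_halfspace_ge)
qed

lemma affine_image_convex_hull:
  fixes f :: "'a::euclidean_space \<Rightarrow> 'b::euclidean_space"
  assumes "finite W" and aff: "\<And>b. b \<in> Basis \<Longrightarrow> affine_fun_on (convex hull W) (\<lambda>z. f z \<bullet> b)"
  shows "f ` (convex hull W) \<subseteq> convex hull (f ` W)"
proof clarify
  fix z assume z: "z \<in> convex hull W"
  then obtain u where u: "\<forall>x\<in>W. 0 \<le> u x" "sum u W = 1" "(\<Sum>x\<in>W. u x *\<^sub>R x) = z"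
    unfolding convex_hull_finite[OF \<open>finite W\<close>] by blast
  have "f z = (\<Sum>x\<in>W. u x *\<^sub>R f x)"
  proof (rule euclidean_eqI)
    fix b :: 'b assume "b \<in> Basis"
    then obtain a c where ac: "\<And>z. z \<in> convex hull W \<Longrightarrow> f z \<bullet> b = a \<bullet> z + c"
      using aff unfolding affine_fun_on_def by meson
    have "(\<Sum>x\<in>W. u x *\<^sub>R f x) \<bullet> b = (\<Sum>x\<in>W. u x * (a \<bullet> x + c))"
      by (simp add: inner_sum_left ac hull_inc)
    also have "\<dots> = a \<bullet> (\<Sum>x\<in>W. u x *\<^sub>R x) + c * sum u W"
      by (simp add: inner_sum_right distrib_left sum.distrib sum_distrib_left mult.commute)
    finally show "f z \<bullet> b = (\<Sum>x\<in>W. u x *\<^sub>R f x) \<bullet> b"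
      using u ac[OF z] by simp
  qed
  also have "\<dots> \<in> convex hull (f ` W)"
    using u \<open>finite W\<close> by (intro convex_sum) (auto intro: hull_inc)
  finally show "f z \<in> convex hull (f ` W)" .
qed

text \<open>
  The set \<open>T\<close> collects the vertices of all the cells on which every coordinate of \<open>f\<close> is affine.
\<close>
lemma piecewise_affine_image_hull:
  fixes f :: "'a::euclidean_space \<Rightarrow> 'b::euclidean_space"
  assumes "polytope Z" and pwa: "\<And>b. b \<in> Basis \<Longrightarrow> piecewise_affine (\<lambda>z. f z \<bullet> b)"
  obtains T where "finite T" "T \<subseteq> Z" "f ` Z \<subseteq> convex hull (f ` T)"
proof -
  obtain \<P> where \<P>: "finite \<P>" "\<Union>\<P> = UNIV"
      "\<And>P. P \<in> \<P> \<Longrightarrow> polyhedron P \<and> (\<forall>b\<in>Basis. affine_fun_on P (\<lambda>z. f z \<bullet> b))"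
    using common_affine_cells[of Basis "\<lambda>b z. f z \<bullet> b"] pwa by (metis finite_Basis)
  have "\<forall>P\<in>\<P>. \<exists>W. finite W \<and> Z \<inter> P = convex hull W"
    using polytope_Int_polyhedron[OF \<open>polytope Z\<close>] \<P>(3) by (simp add: polytope_def)
  then obtain W where W: "\<And>P. P \<in> \<P> \<Longrightarrow> finite (W P) \<and> Z \<inter> P = convex hull W P"
    by metis
  show thesis
  proof
    show "finite (\<Union>P\<in>\<P>. W P)"
      using \<P>(1) W by blast
    show "(\<Union>P\<in>\<P>. W P) \<subseteq> Z"
      using W hull_subset by fastforce
    show "f ` Z \<subseteq> convex hull (f ` (\<Union>P\<in>\<P>. W P))"
    proof clarify
      fix z assume "z \<in> Z"
      obtain P where P: "P \<in> \<P>" "z \<in> P"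
        using \<P>(2) by blast
      have "f ` (convex hull W P) \<subseteq> convex hull (f ` W P)"
      proof (rule affine_image_convex_hull)
        show "finite (W P)" using W P by blast
        show "affine_fun_on (convex hull W P) (\<lambda>z. f z \<bullet> b)" if "b \<in> Basis" for b
          using \<P>(3)[OF P(1)] W[OF P(1)] that by (metis affine_fun_on_subset inf_le2)
      qed
      moreover have "z \<in> convex hull W P"
        using W[OF P(1)] P \<open>z \<in> Z\<close> by blast
      moreover have "convex hull (f ` W P) \<subseteq> convex hull (f ` (\<Union>P\<in>\<P>. W P))"
        using P by (intro hull_mono) auto
      ultimately show "f z \<in> convex hull (f ` (\<Union>P\<in>\<P>. W P))"
        by blast
    qed
  qed
qed

section \<open>Exposed points and normal cones\<close>

lemma convex_normal_cone: "convex (normal_cone P p)"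
  by (auto simp: convex_def normal_cone_def inner_add_left)

text \<open>
  A linear functional that is nonnegative on a convex set and vanishes at a relative interior
  point vanishes on the whole set, because the segment from any point to the relative interior
  point can be prolonged inside the set.
\<close>
lemma rel_interior_vanishing:
  fixes N :: "'a::euclidean_space set"
  assumes "convex N" "\<eta> \<in> rel_interior N" "\<And>\<xi>. \<xi> \<in> N \<Longrightarrow> 0 \<le> \<xi> \<bullet> v" "\<eta> \<bullet> v = 0" "\<xi> \<in> N"
  shows "\<xi> \<bullet> v = 0"
proof -
  obtain e where e: "e > 1" "(1 - e) *\<^sub>R \<xi> + e *\<^sub>R \<eta> \<in> N"
    using assms(1,2,5) by (metis convex_rel_interior_iff empty_iff)
  have "0 \<le> (1 - e) * (\<xi> \<bullet> v)"
    using assms(3)[OF e(2)] assms(4) by (simp add: inner_add_left)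
  then have "\<xi> \<bullet> v \<le> 0"
    using e(1) by (simp add: zero_le_mult_iff)
  then show ?thesis
    using assms(3,5) by fastforce
qed

text \<open>The bidual cone of \<open>K\<close> is contained in \<open>K\<close>, in the form of a separation.\<close>
lemma closed_convex_cone_bipolar:
  fixes K :: "'a::euclidean_space set"
  assumes "closed K" "convex_cone K" "v \<notin> K"
  obtains \<xi> where "\<And>x. x \<in> K \<Longrightarrow> 0 \<le> \<xi> \<bullet> x" "\<xi> \<bullet> v < 0"
proof -
  obtain a b where ab: "a \<bullet> v < b" "\<And>x. x \<in> K \<Longrightarrow> b < a \<bullet> x"
    using separating_hyperplane_closed_point[of K v] assms by (auto simp: convex_cone_def)
  have "b < 0"
    using ab(2)[of 0] convex_cone_contains_0[OF assms(2)] by simp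
  have "0 \<le> a \<bullet> x" if "x \<in> K" for x
  proof (rule ccontr)
    assume neg: "\<not> 0 \<le> a \<bullet> x"
    \<comment> \<open>the multiple of \<open>x\<close> on which \<open>a\<close> takes the value \<open>b\<close>\<close>
    have "(b / (a \<bullet> x)) *\<^sub>R x \<in> K"
      using neg \<open>b < 0\<close> that by (intro convex_cone_scaleR[OF assms(2)]) (auto simp: divide_nonpos_neg)
    from ab(2)[OF this] neg show False
      by simp
  qed
  then show thesis
    using that ab(1) \<open>b < 0\<close> by fastforce
qed

text \<open>
  Without the closed pointed cone \<open>K\<close> around \<open>P - p\<close> a relative interior normal exposes only the
  smallest exposed face containing \<open>p\<close>, which may be larger than \<open>{p}\<close>: the difference
  \<open>v\<close> of \<open>p\<close> and another minimizer is only known to be orthogonal to all normals. The dual of \<open>K\<close>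
  consists of normals, which forces \<open>-v\<close> into \<open>K\<close>.
\<close>
lemma rel_interior_normal_cone_exposes:
  fixes P :: "'a::euclidean_space set"
  assumes K: "closed K" "convex_cone K" "\<And>x. x \<in> K \<Longrightarrow> - x \<in> K \<Longrightarrow> x = 0"
    and P: "p \<in> P" "\<And>q. q \<in> P \<Longrightarrow> q - p \<in> K"
    and \<eta>: "\<eta> \<in> rel_interior (normal_cone P p)"
  shows "argmin_on (\<lambda>q. \<eta> \<bullet> q) P = {p}"
proof -
  have "\<eta> \<in> normal_cone P p"
    using \<eta> rel_interior_subset by blast
  then have min: "\<eta> \<bullet> p \<le> \<eta> \<bullet> q" if "q \<in> P" for q
    using that by (simp add: normal_cone_def inner_diff_right)
  have uniq: "q = p" if q: "q \<in> P" "\<eta> \<bullet> q \<le> \<eta> \<bullet> p" for q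
  proof -
    let ?v = "q - p"
    have "\<eta> \<bullet> ?v = 0"
      using min[OF q(1)] q(2) by (simp add: inner_diff_right)
    then have orth: "\<xi> \<bullet> ?v = 0" if "\<xi> \<in> normal_cone P p" for \<xi>
      using rel_interior_vanishing[OF convex_normal_cone \<eta>, of ?v \<xi>] q(1) that
      by (auto simp: normal_cone_def)
    have "- ?v \<in> K"
    proof (rule ccontr)
      assume "- ?v \<notin> K"
      then obtain \<xi> where \<xi>: "\<And>x. x \<in> K \<Longrightarrow> 0 \<le> \<xi> \<bullet> x" "\<xi> \<bullet> (- ?v) < 0"
        using closed_convex_cone_bipolar[OF K(1,2)] by blast
      then have "\<xi> \<in> normal_cone P p"
        using P(2) by (simp add: normal_cone_def)
      from orth[OF this] \<xi>(2) show False
        unfolding inner_minus_right by simp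
    qed
    then have "?v = 0"
      using K(3) P(2)[OF q(1)] by blast
    then show ?thesis by simp
  qed
  show ?thesis
    using P(1) min uniq by (auto simp: argmin_on_def is_arg_min_linorder)
qed

text \<open>
  The normal cone is invariant under positive scaling, so around \<open>(w, 1)\<close> it contains all
  \<open>(y, t)\<close> for which \<open>t > 0\<close> and \<open>y / t\<close> is in the interior of the region.
\<close>
lemma interior_equiv_region:
  fixes P :: "((real^'l::finite) \<times> real) set"
  assumes "w \<in> interior (equiv_region P p)"
  shows "(w, 1) \<in> interior (normal_cone P p)"
proof (rule interiorI)
  let ?I = "interior (equiv_region P p)"
  let ?h = "\<lambda>x :: (real^'l) \<times> real. (1 / snd x) *\<^sub>R fst x"
  let ?U = "{x. 0 < snd x} \<inter> ?h -` ?I"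
  have "open {x :: (real^'l) \<times> real. 0 < snd x}"
    by (intro open_Collect_less continuous_intros)
  moreover from this have "continuous_on {x :: (real^'l) \<times> real. 0 < snd x} ?h"
    by (auto intro!: continuous_intros)
  ultimately show "open ?U"
    by (intro continuous_open_preimage) auto
  show "(w, 1) \<in> ?U"
    using assms by simp
  show "?U \<subseteq> normal_cone P p"
  proof
    fix x assume x: "x \<in> ?U"
    then have "?h x \<in> equiv_region P p"
      using interior_subset by blast
    then have n: "(?h x, 1) \<in> normal_cone P p"
      by (simp add: equiv_region_def)
    have "x = snd x *\<^sub>R (?h x, 1)"
      using x by (simp add: prod_eq_iff)
    moreover have "snd x *\<^sub>R (?h x, 1) \<in> normal_cone P p"
      using n x by (auto simp: normal_cone_def simp del: scaleR_Pair)
    ultimately show "x \<in> normal_cone P p" by metis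
  qed
qed

section \<open>The lexicographic cone\<close>

definition lex_cone :: "((real^'l::{finite,linorder}) \<times> real) set" where
  "lex_cone = {(y, t). (y = 0 \<and> 0 \<le> t) \<or> (\<exists>i. (\<forall>j<i. y $ j = 0) \<and> 0 < y $ i)}"

lemma lex_cone_cases:
  assumes "x \<in> lex_cone"
  obtains "fst x = 0" "0 \<le> snd x" | i where "\<And>j. j < i \<Longrightarrow> fst x $ j = 0" "0 < fst x $ i"
  using assms unfolding lex_cone_def by (auto 4 3 simp: case_prod_beta)

lemma lex_coneI1: "fst x = 0 \<Longrightarrow> 0 \<le> snd x \<Longrightarrow> x \<in> lex_cone"
  by (auto simp: lex_cone_def case_prod_beta)

lemma lex_coneI2: "(\<And>j. j < i \<Longrightarrow> fst x $ j = 0) \<Longrightarrow> 0 < fst x $ i \<Longrightarrow> x \<in> lex_cone"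
  by (auto simp: lex_cone_def case_prod_beta)

lemma lex_cone_add:
  fixes x y :: "(real^'l::{finite,linorder}) \<times> real"
  assumes "x \<in> lex_cone" "y \<in> lex_cone"
  shows "x + y \<in> lex_cone"
  using assms(1)
proof (cases rule: lex_cone_cases)
  case 1
  note x = 1
  show ?thesis
    using assms(2)
  proof (cases rule: lex_cone_cases)
    case 1
    then show ?thesis using x by (intro lex_coneI1) auto
  next
    case (2 i)
    then show ?thesis using x by (intro lex_coneI2[of i]) auto
  qed
next
  case x: (2 i)
  show ?thesis
    using assms(2)
  proof (cases rule: lex_cone_cases)
    case 1
    then show ?thesis
      using x by (auto intro: lex_coneI2[of i])
  next
    case y: (2 k)
    consider "i < k" | "i = k" | "k < i"
      by fastforce
    then show ?thesis
    proof cases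
      case 1 then show ?thesis using x y by (intro lex_coneI2[of i]) auto
    next
      case 2 then show ?thesis using x y by (intro lex_coneI2[of i]) auto
    next
      case 3 then show ?thesis using x y by (intro lex_coneI2[of k]) auto
    qed
  qed
qed

lemma convex_cone_lex_cone: "convex_cone (lex_cone :: ((real^'l::{finite,linorder}) \<times> real) set)"
proof -
  have "c *\<^sub>R x \<in> lex_cone" if "x \<in> lex_cone" "0 \<le> c" for c and x :: "(real^'l::{finite,linorder}) \<times> real"
  proof (cases "c = 0")
    case True
    then show ?thesis by (auto intro: lex_coneI1)
  next
    case False
    with that(2) have "0 < c" by simp
    show ?thesis
      using that(1)
    proof (cases rule: lex_cone_cases)
      case 1
      then show ?thesis using that(2) by (intro lex_coneI1) auto
    next
      case (2 i)
      then show ?thesis using \<open>0 < c\<close> by (intro lex_coneI2[of i]) auto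
    qed
  qed
  moreover have "(0 :: (real^'l::{finite,linorder}) \<times> real) \<in> lex_cone"
    by (auto intro: lex_coneI1)
  ultimately show ?thesis
    unfolding convex_cone_iff using lex_cone_add by blast
qed

lemma lex_cone_pointed:
  fixes x :: "(real^'l::{finite,linorder}) \<times> real"
  assumes x: "x \<in> lex_cone" and mx: "- x \<in> lex_cone"
  shows "x = 0"
  using x
proof (cases rule: lex_cone_cases)
  case 1
  show ?thesis
    using mx 1 by (cases rule: lex_cone_cases) (auto simp: prod_eq_iff)
next
  case x: (2 i)
  show ?thesis
    using mx
  proof (cases rule: lex_cone_cases)
    case 1
    then show ?thesis using x by simp
  next
    case y: (2 k)
    have "i < k \<or> i = k \<or> k < i" by fastforce
    then show ?thesis using x y by (auto dest: x(1) y(1))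
  qed
qed

lemma Basis_subset_lex_cone: "(Basis :: ((real^'l::{finite,linorder}) \<times> real) set) \<subseteq> lex_cone"
proof
  fix b :: "(real^'l::{finite,linorder}) \<times> real" assume "b \<in> Basis"
  then consider i where "b = (axis i 1, 0)" | "b = (0, 1)"
    by (auto simp: Basis_prod_def Basis_vec_def)
  then show "b \<in> lex_cone"
  proof cases
    case (1 i)
    then show ?thesis by (intro lex_coneI2[of i]) (auto simp: axis_def)
  next
    case 2
    then show ?thesis by (intro lex_coneI1) auto
  qed
qed

section \<open>The cascade and the lexicographic order\<close>

lemma cascade_antimono: "k \<le> n \<Longrightarrow> cascade V Z n \<subseteq> cascade V Z k"
  by (induction rule: dec_induct) auto

lemma card_lessThan_less: "card {..<i} < CARD('l)" for i :: "'l::{finite,linorder}"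
  by (intro psubset_card_mono) auto

lemma card_lessThan_surj:
  assumes "k < CARD('l::{finite,linorder})"
  obtains i :: "'l::{finite,linorder}" where "card {..<i} = k"
proof -
  have "inj (\<lambda>i :: 'l. card {..<i})"
    by (rule inj_on_inverseI[where g = level]) (rule level_card_lessThan)
  then have "card (range (\<lambda>i :: 'l. card {..<i})) = CARD('l)"
    by (rule card_image)
  moreover have "range (\<lambda>i :: 'l. card {..<i}) \<subseteq> {..<CARD('l)}"
    by (auto simp: card_lessThan_less)
  ultimately have "range (\<lambda>i :: 'l. card {..<i}) = {..<CARD('l)}"
    by (intro card_subset_eq) auto
  then show thesis
    using assms that by (metis imageE lessThan_iff)
qed

text \<open>
  Stated for all \<open>k\<close> up to the number of levels, which is the form that the induction needs;
  beyond that number \<open>level k\<close> denotes no level.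
\<close>
lemma mem_cascade_iff:
  fixes V :: "'l::{finite,linorder} \<Rightarrow> 'a \<Rightarrow> real"
  assumes "k \<le> CARD('l)"
  shows "z \<in> cascade V Z k \<longleftrightarrow> z \<in> Z \<and> (\<forall>i. card {..<i} < k \<longrightarrow> V i z = V_star V Z i)"
  using assms
proof (induction k)
  case 0
  show ?case by simp
next
  case (Suc k)
  obtain i :: 'l where i: "card {..<i} = k"
    using card_lessThan_surj Suc.prems by (metis Suc_le_lessD)
  then have lev: "level k = i"
    using level_card_lessThan by metis
  have "z \<in> cascade V Z (Suc k) \<longleftrightarrow> z \<in> cascade V Z k \<and> V i z = V_star V Z i"
    by (simp add: lev V_star_def before_level_def i)
  moreover have "card {..<j} < Suc k \<longleftrightarrow> card {..<j} < k \<or> j = i" for j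
    using i by (metis less_Suc_eq level_card_lessThan)
  ultimately show ?case
    using Suc by auto
qed

lemma mem_cascade_CARD_iff:
  fixes V :: "'l::{finite,linorder} \<Rightarrow> 'a \<Rightarrow> real"
  shows "z \<in> cascade V Z CARD('l) \<longleftrightarrow> z \<in> Z \<and> (\<forall>i. V i z = V_star V Z i)"
  by (simp add: mem_cascade_iff card_lessThan_less)

text \<open>
  At the first level \<open>i\<close> where \<open>z\<close> misses the optimal value, \<open>z\<close> still competes in the
  minimization of \<open>V i\<close>, so it can only be worse there.
\<close>
lemma lex_optimum_diff_in_lex_cone:
  fixes V :: "'l::{finite,linorder} \<Rightarrow> 'a \<Rightarrow> real"
  assumes att: "\<And>i. argmin_on (V i) (before_level V Z i) \<noteq> {}"
    and opt: "zlex \<in> lex_optima V J Z" and z: "z \<in> Z"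
  shows "((\<chi> i. V i z), J z) - ((\<chi> i. V_star V Z i), J zlex) \<in> lex_cone"
proof (cases "\<forall>i. V i z = V_star V Z i")
  case True
  then have "z \<in> cascade V Z CARD('l)"
    using z by (simp add: mem_cascade_CARD_iff)
  then have "J zlex \<le> J z"
    using opt by (auto simp: lex_optima_def argmin_on_def is_arg_min_linorder)
  then show ?thesis
    using True by (intro lex_coneI1) (auto simp: vec_eq_iff)
next
  case False
  let ?B = "{i. V i z \<noteq> V_star V Z i}"
  define i where "i = Min ?B"
  have i: "V i z \<noteq> V_star V Z i"
    using False Min_in[of ?B] by (auto simp: i_def)
  have below: "V j z = V_star V Z j" if "j < i" for j
    using that Min_le[of ?B j] unfolding i_def by (meson finite leD mem_Collect_eq)
  have "j < i" if "card {..<j} < card {..<i}" for j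
    using that by (metis card_mono finite leD lessThan_subset_iff linorder_le_less_linear)
  then have "z \<in> before_level V Z i"
    using z below card_lessThan_less[of i] by (simp add: before_level_def mem_cascade_iff)
  moreover obtain x where x: "x \<in> argmin_on (V i) (before_level V Z i)"
    using att by blast
  ultimately have "V i x \<le> V i z"
    by (auto simp: argmin_on_def is_arg_min_linorder)
  moreover have "V i x = V_star V Z i"
    using argmin_on_Inf[OF x] by (simp add: V_star_def)
  ultimately have "V_star V Z i < V i z"
    using i by fastforce
  then show ?thesis
    using below by (intro lex_coneI2[of i]) auto
qed

section \<open>The upper image inside a closed pointed cone\<close>

lemma mem_convex_cone_Basis:
  fixes x :: "'a::euclidean_space"
  assumes "convex_cone K" "Basis \<subseteq> K" "\<And>b. b \<in> Basis \<Longrightarrow> 0 \<le> x \<bullet> b"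
  shows "x \<in> K"
proof -
  have sum: "sum h B \<in> K" if "finite B" "\<And>b. b \<in> B \<Longrightarrow> h b \<in> K" for h :: "'a \<Rightarrow> 'a" and B
    using that
    by (induction B rule: finite_induct)
      (auto intro: convex_cone_add[OF assms(1)] convex_cone_contains_0[OF assms(1)])
  have "(\<Sum>b\<in>Basis. (x \<bullet> b) *\<^sub>R b) \<in> K"
    using assms by (intro sum) (auto intro: convex_cone_scaleR)
  then show ?thesis
    by (simp add: euclidean_representation)
qed

text \<open>
  The cone \<open>K\<close> is generated by the finitely many \<open>f v - p\<close> with \<open>v\<close> a vertex of a cell, together with
  the unit vectors, which account for the slack in the definition of the upper image.
  Finite generation makes \<open>K\<close> closed, so that it also contains the limit points of \<open>P - p\<close>.
\<close>
lemma upper_image_in_closed_cone: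
  fixes V :: "'l::{finite,linorder} \<Rightarrow> 'a::euclidean_space \<Rightarrow> real"
  assumes "polytope Z" "\<And>i. piecewise_affine (V i)" "piecewise_affine J"
    and C: "convex_cone C" "Basis \<subseteq> C" "\<And>z. z \<in> Z \<Longrightarrow> ((\<chi> i. V i z), J z) - p \<in> C"
  obtains K where "closed K" "convex_cone K" "K \<subseteq> C" "\<And>q. q \<in> upper_image V J Z \<Longrightarrow> q - p \<in> K"
proof -
  define f where "f = (\<lambda>z. ((\<chi> i. V i z) :: real^'l::{finite,linorder}, J z))"
  have "piecewise_affine (\<lambda>z. f z \<bullet> b)" if "b \<in> Basis" for b
  proof -
    from that consider i where "b = (axis i 1, 0)" | "b = (0, 1)"
      by (auto simp: Basis_prod_def Basis_vec_def)
    then show ?thesis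
      using assms(2,3) by cases (auto simp: f_def inner_axis)
  qed
  then obtain T where T: "finite T" "T \<subseteq> Z" "f ` Z \<subseteq> convex hull (f ` T)"
    using piecewise_affine_image_hull[OF assms(1), of f] by blast
  define K where "K = convex_cone hull ((\<lambda>v. f v - p) ` T \<union> Basis)"
  have K: "convex_cone K"
    unfolding K_def by (rule convex_cone_convex_cone_hull)
  have "closed K"
    unfolding K_def using T(1) by (intro closed_convex_cone_hull) simp
  have "Basis \<subseteq> K"
    unfolding K_def by (auto intro: hull_inc)
  have "K \<subseteq> C"
    unfolding K_def using T(2) C by (intro hull_minimal) (auto simp: f_def)
  have "convex ((+) p ` K)"
    using K by (simp add: convex_cone_def convex_translation_eq)
  moreover have "f ` T \<subseteq> (+) p ` K"
  proof (rule image_subsetI)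
    fix v assume "v \<in> T"
    then have "f v - p \<in> K"
      unfolding K_def by (auto intro: hull_inc)
    then show "f v \<in> (+) p ` K"
      by (intro image_eqI[of _ _ "f v - p"]) auto
  qed
  ultimately have "convex hull (f ` T) \<subseteq> (+) p ` K"
    by (intro hull_minimal)
  then have f: "f z - p \<in> K" if "z \<in> Z" for z
    using T(3) that by fastforce
  have "{(y, t). \<exists>z\<in>Z. (\<forall>i. V i z \<le> y $ i) \<and> J z \<le> t} \<subseteq> (+) p ` K" (is "?S \<subseteq> _")
  proof
    fix q assume q: "q \<in> ?S"
    obtain z where z: "z \<in> Z" "\<And>i. V i z \<le> fst q $ i" "J z \<le> snd q"
      using q by (auto simp: case_prod_beta)
    have "q - f z \<in> K"
    proof (rule mem_convex_cone_Basis[OF K \<open>Basis \<subseteq> K\<close>])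
      fix b :: "(real^'l::{finite,linorder}) \<times> real" assume "b \<in> Basis"
      then consider i where "b = (axis i 1, 0)" | "b = (0, 1)"
        by (auto simp: Basis_prod_def Basis_vec_def)
      then show "0 \<le> (q - f z) \<bullet> b"
        using z by cases (auto simp: f_def inner_axis inner_prod_def)
    qed
    then have "q - p \<in> K"
      using convex_cone_add[OF K _ f[OF z(1)]] by fastforce
    then show "q \<in> (+) p ` K"
      by (intro image_eqI[of _ _ "q - p"]) auto
  qed
  then have "upper_image V J Z \<subseteq> (+) p ` K"
    unfolding upper_image_def using \<open>closed K\<close> by (intro closure_minimal closed_translation)
  then have "\<And>q. q \<in> upper_image V J Z \<Longrightarrow> q - p \<in> K"
    by fastforce
  then show thesis
    using that \<open>closed K\<close> K \<open>K \<subseteq> C\<close> by blast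
qed

section \<open>Weighted-sum minimizers\<close>

lemma weighted_sum_eq_inner:
  "J z + (\<Sum>i\<in>UNIV. w $ i * V i z) = (w, 1) \<bullet> ((\<chi> i. V i z), J z)"
  by (simp add: inner_prod_def inner_vec_def)

lemma image_in_upper_image: "z \<in> Z \<Longrightarrow> ((\<chi> i. V i z), J z) \<in> upper_image V J Z"
  unfolding upper_image_def by (rule subsetD[OF closure_subset]) auto

lemma lex_optimum_image:
  fixes V :: "'l::{finite,linorder} \<Rightarrow> 'a \<Rightarrow> real"
  assumes "zlex \<in> lex_optima V J Z"
  shows "zlex \<in> Z" "((\<chi> i. V_star V Z i), J zlex) = ((\<chi> i. V i zlex), J zlex)"
  using assms by (auto simp: lex_optima_def argmin_on_def is_arg_min_linorder mem_cascade_CARD_iff)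

lemma ws_optima_eq_lex_optima:
  fixes V :: "'l::{finite,linorder} \<Rightarrow> 'a \<Rightarrow> real"
  assumes exp: "argmin_on (\<lambda>q. (w, 1) \<bullet> q) (upper_image V J Z) = {p}"
    and opt: "zlex \<in> lex_optima V J Z" and p: "p = ((\<chi> i. V_star V Z i), J zlex)"
  shows "ws_optima V J Z w = lex_optima V J Z"
proof -
  have J: "J z = J zlex" if "z \<in> lex_optima V J Z" for z
    using that opt by (force simp: lex_optima_def argmin_on_def is_arg_min_linorder)
  have lex: "z \<in> lex_optima V J Z \<longleftrightarrow> z \<in> Z \<and> ((\<chi> i. V i z), J z) = p" for z
    using opt J[of z]
    by (auto simp: p vec_eq_iff lex_optima_def argmin_on_def is_arg_min_linorder mem_cascade_CARD_iff)
  have min: "(w, 1) \<bullet> p \<le> (w, 1) \<bullet> ((\<chi> i. V i z), J z)" if "z \<in> Z" for z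
    using exp image_in_upper_image[OF that, of V J] by (auto simp: argmin_on_def is_arg_min_linorder)
  have uniq: "((\<chi> i. V i z), J z) = p"
    if "z \<in> Z" "(w, 1) \<bullet> ((\<chi> i. V i z), J z) \<le> (w, 1) \<bullet> p" for z
  proof -
    have "((\<chi> i. V i z), J z) \<in> argmin_on (\<lambda>q. (w, 1) \<bullet> q) (upper_image V J Z)"
    proof -
      have "p \<in> argmin_on (\<lambda>q. (w, 1) \<bullet> q) (upper_image V J Z)"
        using exp by simp
      then show ?thesis
        unfolding argmin_on_def is_arg_min_linorder
        using image_in_upper_image[OF that(1), of V J] that(2) by (blast intro: order_trans)
    qed
    then show ?thesis using exp by simp
  qed
  have ws: "z \<in> ws_optima V J Z w \<longleftrightarrow> z \<in> Z \<and>
      (\<forall>z'\<in>Z. (w, 1) \<bullet> ((\<chi> i. V i z), J z) \<le> (w, 1) \<bullet> ((\<chi> i. V i z'), J z'))" for z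
    by (auto simp: ws_optima_def argmin_on_def is_arg_min_linorder weighted_sum_eq_inner
        simp del: inner_Pair)
  have "zlex \<in> Z" "((\<chi> i. V i zlex), J zlex) = p"
    using opt lex by auto
  then show ?thesis
    using ws lex min uniq by (intro set_eqI) metis
qed

section \<open>Equivalence of weighted-sum and lexicographic optima\<close>

theorem mainTheorem4:
  fixes Z :: "(real^'d::finite) set"
    and J :: "real^'d \<Rightarrow> real"
    and m :: "'l::{finite,linorder} \<Rightarrow> nat"
    and g :: "'l \<Rightarrow> nat \<Rightarrow> real^'d \<Rightarrow> real"
    and V :: "'l \<Rightarrow> real^'d \<Rightarrow> real"
    and zlex :: "real^'d"
    and pstar :: "(real^'l::{finite,linorder}) \<times> real"
    and P :: "((real^'l::{finite,linorder}) \<times> real) set"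
  assumes m_pos: "\<And>i. 1 \<le> m i"
    and Z_poly: "polyhedron Z"
    and g_affine: "\<And>i j. 1 \<le> j \<Longrightarrow> j \<le> m i \<Longrightarrow> affine_fun_on UNIV (g i j)"
    and J_convex: "convex_on UNIV J"
    and J_pwa: "piecewise_affine J"
    and V_eq: "V = violation m g"
    and Z_compact: "compact Z"
    and cascade_attained: "\<And>i. argmin_on (V i) (before_level V Z i) \<noteq> {}"
    and lex_nonempty: "lex_optima V J Z \<noteq> {}"
    and ws_nonempty: "\<And>w. w \<in> pos_orthant \<Longrightarrow> ws_optima V J Z w \<noteq> {}"
    and lex_unique: "lex_optima V J Z = {zlex}"
    and pstar_eq: "pstar = ((\<chi> i. V_star V Z i), J zlex)"
    and P_eq: "P = upper_image V J Z"
  shows "(\<forall>w\<in>equiv_region P pstar. (w, 1) \<in> rel_interior (normal_cone P pstar) \<longrightarrow>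
            argmin_on (\<lambda>q. (w, 1) \<bullet> q) P = {pstar} \<and>
            ws_optima V J Z w = {zlex})
       \<and> ((\<exists>w\<in>pos_orthant. (w, 1) \<in> interior (normal_cone P pstar)) \<longrightarrow>
            (\<forall>w\<in>interior (equiv_region P pstar).
               ws_optima V J Z w = {zlex} \<and>
               (\<forall>z\<in>ws_optima V J Z w. compliance V z = compliance V zlex)))"
proof -
  have lex: "zlex \<in> lex_optima V J Z"
    using lex_unique by simp
  have "piecewise_affine (V i)" for i
    unfolding V_eq violation_def
    by (intro piecewise_affine_sum piecewise_affine_pos_part g_affine) auto
  moreover have "polytope Z"
    using Z_poly Z_compact by (simp add: polytope_eq_bounded_polyhedron compact_imp_bounded)
  ultimately obtain K where K: "closed K" "convex_cone K" "K \<subseteq> lex_cone"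
      "\<And>q. q \<in> P \<Longrightarrow> q - pstar \<in> K"
    using upper_image_in_closed_cone[OF _ _ J_pwa convex_cone_lex_cone Basis_subset_lex_cone]
      lex_optimum_diff_in_lex_cone[OF cascade_attained lex] unfolding P_eq pstar_eq by blast
  have "pstar \<in> P"
    unfolding P_eq pstar_eq lex_optimum_image(2)[OF lex]
    by (rule image_in_upper_image[OF lex_optimum_image(1)[OF lex]])
  have expo: "argmin_on (\<lambda>q. (w, 1) \<bullet> q) P = {pstar}" and ws: "ws_optima V J Z w = {zlex}"
    if "(w, 1) \<in> rel_interior (normal_cone P pstar)" for w
  proof -
    show e: "argmin_on (\<lambda>q. (w, 1) \<bullet> q) P = {pstar}"
      using rel_interior_normal_cone_exposes[OF K(1,2) _ \<open>pstar \<in> P\<close> K(4) that]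
        lex_cone_pointed K(3) by blast
    show "ws_optima V J Z w = {zlex}"
      using ws_optima_eq_lex_optima[OF e[unfolded P_eq] lex pstar_eq] lex_unique by simp
  qed
  have "ws_optima V J Z w = {zlex}" if "w \<in> interior (equiv_region P pstar)" for w
    using ws interior_equiv_region[OF that] interior_subset_rel_interior by blast
  then show ?thesis
    using expo ws by simp
qed

end
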